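(* For $i=1,2$ let $(B_i,+,\cdot)$ be a skew left brace with additive group $K_i$, multiplicative group $C_i$ and lambda map $\lambda_i\colon C_i\to\operatorname{Aut}(K_i)$, and let $(G_i,K_i,H_i,E_i)$ be a trifactorised group associated with $B_i$ with corresponding epimorphism $\eta_i\colon C_i\to E_i$. Let $f\colon B_1\to B_2$ be a brace homomorphism such that $f(\ker\eta_1)\le\ker\eta_2$. Then: (1) The map $\bar f\colon (G_1,K_1,H_1,E_1)\to(G_2,K_2,H_2,E_2)$ given by $\bar f(k\,\eta_1(c))=f(k)\,\eta_2(f(c))$ for $k\in K_1$, $c\in C_1$ is a morphism of trifactorised groups. (2) $\mathsf{B}(\bar f)=f$. (3) If $f$ is an epimorphism, then $\bar f$ is an epimorphism. (4) $\bar f$ is a monomorphism (resp. isomorphism) if and only if $f$ is a monomorphism (resp. isomorphism) and $f(\ker\eta_1)=\ker\eta_2$.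
   Context: A skew left brace $(B,+,\cdot)$ is a set with two group operations ($+$ not necessarily commutative) such that $a(b+c)=ab-a+ac$ for all $a,b,c\in B$. Its lambda map is the homomorphism $\lambda\colon (B,\cdot)\to\operatorname{Aut}(B,+)$, $\lambda_a(b)=-a+ab$. A brace homomorphism is a map preserving both operations. A trifactorised group is a tuple $(G,K,H,E)$ with $G$ a group, $K\trianglelefteq G$, $H,E\le G$, $G=KE=KH=HE$ and $K\cap E=H\cap E=1$. A morphism $(G_1,K_1,H_1,E_1)\to(G_2,K_2,H_2,E_2)$ is a group homomorphism $g\colon G_1\to G_2$ with $g(K_1)\le K_2$, $g(H_1)\le H_2$, $g(E_1)\le E_2$. Monomorphism, epimorphism, isomorphism mean injective, surjective, bijective homomorphism (of braces or trifactorised groups). Trifactorised groups associated with a brace: let $K=(B,+)$, $C=(B,\cdot)$, let $\delta\colon C\to K$ be the identity map of $B$, and let $\eta\colon C\to E$ be a surjective group homomorphism with $\ker\eta\le\ker\lambda$. Then $E$ acts on $K$ by $\bar\lambda(\eta(c))=\lambda(c)$; put $G=K\rtimes E$ (with $K$, $E$ identified with their copies in $G$) and $H=\{\delta(c)\eta(c)\mid c\in C\}\le G$. The tuple $(G,K,H,E)$ is the trifactorised group associated with $B$ with corresponding epimorphism $\eta$. For a morphism $g\colon (G_1,K_1,H_1,E_1)\to(G_2,K_2,H_2,E_2)$ between trifactorised groups associated with braces $B_1$ and $B_2$, $\mathsf{B}(g)$ denotes the restriction $g|_{K_1}\colon K_1\to K_2$, which is a brace homomorphism $B_1\to B_2$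.
   Formalization: In (4), the monomorphism criterion is corrected to f mono and f(ker η1) = ker η2 ∩ f(B1), since the printed "only if" fails for 0 → ℤ with E1 = E2 = 1; the printed "if" direction and the isomorphism criterion are kept. *)

theory Defs
  imports "HOL-Algebra.Bij" "HOL-Algebra.Coset" "HOL-Algebra.Ring"
begin

section \<open>Skew left braces\<close>

text \<open>A skew left brace is carried by the record \<open>ring\<close>, whose fields provide two operations on one
  carrier; none of the ring axioms is assumed. Its additive group is \<open>add_monoid B\<close>, and \<open>B\<close> itself,
  read as a monoid record, is its multiplicative group. Addition need not be commutative, so the
  order of the summands matters.\<close>

locale skew_left_brace =
  fixes B :: "('b, 'm) ring_scheme" (structure)
  assumes add_group: "group (add_monoid B)"
    and mult_group: "group B"
    and brace_distrib: "\<lbrakk>a \<in> carrier B; b \<in> carrier B; c \<in> carrier B\<rbrakk>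
      \<Longrightarrow> a \<otimes> (b \<oplus> c) = ((a \<otimes> b) \<oplus> (\<ominus> a)) \<oplus> (a \<otimes> c)"

text \<open>Restricted to the carrier because \<^const>\<open>AutoGroup\<close> consists of extensional functions.\<close>

definition brace_lambda :: "('b, 'm) ring_scheme \<Rightarrow> 'b \<Rightarrow> 'b \<Rightarrow> 'b"
  where "brace_lambda B a = (\<lambda>b\<in>carrier B. (\<ominus>\<^bsub>B\<^esub> a) \<oplus>\<^bsub>B\<^esub> (a \<otimes>\<^bsub>B\<^esub> b))"

definition brace_hom :: "('b, 'm) ring_scheme \<Rightarrow> ('c, 'n) ring_scheme \<Rightarrow> ('b \<Rightarrow> 'c) set"
  where "brace_hom B B' = hom (add_monoid B) (add_monoid B') \<inter> hom B B'"

definition brace_mon :: "('b, 'm) ring_scheme \<Rightarrow> ('c, 'n) ring_scheme \<Rightarrow> ('b \<Rightarrow> 'c) set"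
  where "brace_mon B B' = {f \<in> brace_hom B B'. inj_on f (carrier B)}"

definition brace_epi :: "('b, 'm) ring_scheme \<Rightarrow> ('c, 'n) ring_scheme \<Rightarrow> ('b \<Rightarrow> 'c) set"
  where "brace_epi B B' = {f \<in> brace_hom B B'. f ` carrier B = carrier B'}"

definition brace_iso :: "('b, 'm) ring_scheme \<Rightarrow> ('c, 'n) ring_scheme \<Rightarrow> ('b \<Rightarrow> 'c) set"
  where "brace_iso B B' = {f \<in> brace_hom B B'. bij_betw f (carrier B) (carrier B')}"


section \<open>Trifactorised groups\<close>

type_synonym 'g trifact = "'g monoid \<times> 'g set \<times> 'g set \<times> 'g set"

definition trifactorised_group :: "'g trifact \<Rightarrow> bool"
  where "trifactorised_group = (\<lambda>(G, K, H, E).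
    group G \<and> K \<lhd> G \<and> subgroup H G \<and> subgroup E G \<and>
    carrier G = K <#>\<^bsub>G\<^esub> E \<and> carrier G = K <#>\<^bsub>G\<^esub> H \<and> carrier G = H <#>\<^bsub>G\<^esub> E \<and>
    K \<inter> E = {\<one>\<^bsub>G\<^esub>} \<and> H \<inter> E = {\<one>\<^bsub>G\<^esub>})"

text \<open>Used only between tuples satisfying \<^const>\<open>trifactorised_group\<close>; for those associated with a
  brace, see \<open>trifactorised_assoc_trifact\<close> below.\<close>

definition trifact_hom :: "'g trifact \<Rightarrow> 'h trifact \<Rightarrow> ('g \<Rightarrow> 'h) set"
  where "trifact_hom = (\<lambda>(G, K, H, E) (G', K', H', E').
    {g \<in> hom G G'. g ` K \<subseteq> K' \<and> g ` H \<subseteq> H' \<and> g ` E \<subseteq> E'})"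

definition trifact_mon :: "'g trifact \<Rightarrow> 'h trifact \<Rightarrow> ('g \<Rightarrow> 'h) set"
  where "trifact_mon T T' = {g \<in> trifact_hom T T'. inj_on g (carrier (fst T))}"

definition trifact_epi :: "'g trifact \<Rightarrow> 'h trifact \<Rightarrow> ('g \<Rightarrow> 'h) set"
  where "trifact_epi T T' = {g \<in> trifact_hom T T'. g ` carrier (fst T) = carrier (fst T')}"

definition trifact_iso :: "'g trifact \<Rightarrow> 'h trifact \<Rightarrow> ('g \<Rightarrow> 'h) set"
  where "trifact_iso T T' = {g \<in> trifact_hom T T'. bij_betw g (carrier (fst T)) (carrier (fst T'))}"


section \<open>Trifactorised groups associated with a brace\<close>

definition semidirect ::
    "('k, 'm) monoid_scheme \<Rightarrow> ('e, 'n) monoid_scheme \<Rightarrow> ('e \<Rightarrow> 'k \<Rightarrow> 'k) \<Rightarrow> ('k \<times> 'e) monoid"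
  where "semidirect K E \<phi> =
    \<lparr>carrier = carrier K \<times> carrier E,
     mult = (\<lambda>(k, e) (k', e'). (k \<otimes>\<^bsub>K\<^esub> \<phi> e k', e \<otimes>\<^bsub>E\<^esub> e')),
     one = (\<one>\<^bsub>K\<^esub>, \<one>\<^bsub>E\<^esub>)\<rparr>"

locale brace_with_epi = skew_left_brace B + E: group E
  for B :: "('b, 'm) ring_scheme" (structure) and E :: "('e, 'n) monoid_scheme" +
  fixes \<eta> :: "'b \<Rightarrow> 'e"
  assumes eta_epi: "\<eta> \<in> epi B E"
    and ker_eta: "kernel B E \<eta> \<subseteq> kernel B (AutoGroup (add_monoid B)) (brace_lambda B)"

text \<open>The action of \<open>E\<close> on the additive group: \<open>lambda_bar B \<eta> (\<eta> c)\<close> is \<open>brace_lambda B c\<close>, see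
  \<open>lambda_bar_eta\<close> below.\<close>

definition lambda_bar :: "('b, 'm) ring_scheme \<Rightarrow> ('b \<Rightarrow> 'e) \<Rightarrow> 'e \<Rightarrow> 'b \<Rightarrow> 'b"
  where "lambda_bar B \<eta> e = (THE \<phi>. \<exists>c\<in>carrier B. \<eta> c = e \<and> \<phi> = brace_lambda B c)"

definition assoc_group ::
    "('b, 'm) ring_scheme \<Rightarrow> ('e, 'n) monoid_scheme \<Rightarrow> ('b \<Rightarrow> 'e) \<Rightarrow> ('b \<times> 'e) monoid"
  where "assoc_group B E \<eta> = semidirect (add_monoid B) E (lambda_bar B \<eta>)"

text \<open>The embeddings of the additive group and of \<open>E\<close> that identify them with subgroups of
  \<^const>\<open>assoc_group\<close>.\<close>

definition inclK :: "('e, 'n) monoid_scheme \<Rightarrow> 'b \<Rightarrow> 'b \<times> 'e"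
  where "inclK E k = (k, \<one>\<^bsub>E\<^esub>)"

definition inclE :: "('b, 'm) ring_scheme \<Rightarrow> 'e \<Rightarrow> 'b \<times> 'e"
  where "inclE B e = (\<zero>\<^bsub>B\<^esub>, e)"

definition assoc_trifact ::
    "('b, 'm) ring_scheme \<Rightarrow> ('e, 'n) monoid_scheme \<Rightarrow> ('b \<Rightarrow> 'e) \<Rightarrow> ('b \<times> 'e) trifact"
  where "assoc_trifact B E \<eta> =
    (assoc_group B E \<eta>,
     inclK E ` carrier B,
     {inclK E c \<otimes>\<^bsub>assoc_group B E \<eta>\<^esub> inclE B (\<eta> c) |c. c \<in> carrier B},
     inclE B ` carrier E)"

text \<open>The restriction of \<open>g\<close> to the copies of the additive groups, read as a map from \<open>B1\<close> to \<open>B2\<close>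
  through their embeddings.\<close>

definition brace_restriction ::
    "('b, 'm) ring_scheme \<Rightarrow> ('e, 'n) monoid_scheme \<Rightarrow> ('c, 'p) ring_scheme \<Rightarrow> ('d, 'q) monoid_scheme
      \<Rightarrow> ('b \<times> 'e \<Rightarrow> 'c \<times> 'd) \<Rightarrow> 'b \<Rightarrow> 'c"
  where "brace_restriction B1 E1 B2 E2 g =
    (\<lambda>b\<in>carrier B1. inv_into (carrier B2) (inclK E2) (g (inclK E1 b)))"

text \<open>The formula \<open>k \<eta>1(c) \<mapsto> f(k) \<eta>2(f(c))\<close>; it determines \<open>g\<close> on the carrier of the first group,
  but that such a \<open>g\<close> exists is not immediate.\<close>

definition is_induced_map ::
    "('b, 'm) ring_scheme \<Rightarrow> ('e, 'n) monoid_scheme \<Rightarrow> ('b \<Rightarrow> 'e)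
      \<Rightarrow> ('c, 'p) ring_scheme \<Rightarrow> ('d, 'q) monoid_scheme \<Rightarrow> ('c \<Rightarrow> 'd)
      \<Rightarrow> ('b \<Rightarrow> 'c) \<Rightarrow> ('b \<times> 'e \<Rightarrow> 'c \<times> 'd) \<Rightarrow> bool"
  where "is_induced_map B1 E1 \<eta>1 B2 E2 \<eta>2 f g \<longleftrightarrow>
    (\<forall>k\<in>carrier B1. \<forall>c\<in>carrier B1.
      g (inclK E1 k \<otimes>\<^bsub>assoc_group B1 E1 \<eta>1\<^esub> inclE B1 (\<eta>1 c)) =
      inclK E2 (f k) \<otimes>\<^bsub>assoc_group B2 E2 \<eta>2\<^esub> inclE B2 (\<eta>2 (f c)))"

section \<open>Basic facts\<close>

context skew_left_brace
begin

interpretation A: group "add_monoid B"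
  rewrites "carrier (add_monoid B) = carrier B"
    and "mult (add_monoid B) = add B"
    and "one (add_monoid B) = \<zero>"
    and "m_inv (add_monoid B) = a_inv B"
  using add_group by (auto simp: a_inv_def)

interpretation M: group B by (rule mult_group)

lemma zero_eq_one: "\<zero> = \<one>"
proof -
  have "\<one> \<otimes> (\<zero> \<oplus> \<zero>) = (\<one> \<otimes> \<zero> \<oplus> (\<ominus> \<one>)) \<oplus> (\<one> \<otimes> \<zero>)"
    by (rule brace_distrib) simp_all
  then have "\<ominus> \<one> = \<zero>"
    by simp
  then show ?thesis
    by (metis A.inv_inv A.inv_one M.one_closed)
qed

lemma mult_eq: "\<lbrakk>a \<in> carrier B; b \<in> carrier B\<rbrakk> \<Longrightarrow> a \<otimes> b = a \<oplus> brace_lambda B a b"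
  by (simp add: brace_lambda_def A.m_assoc[symmetric])

lemma lambda_closed: "\<lbrakk>a \<in> carrier B; b \<in> carrier B\<rbrakk> \<Longrightarrow> brace_lambda B a b \<in> carrier B"
  by (simp add: brace_lambda_def)

lemma lambda_add:
  "\<lbrakk>a \<in> carrier B; b \<in> carrier B; c \<in> carrier B\<rbrakk>
    \<Longrightarrow> brace_lambda B a (b \<oplus> c) = brace_lambda B a b \<oplus> brace_lambda B a c"
  by (simp add: brace_lambda_def brace_distrib A.m_assoc)

lemma lambda_mult:
  assumes "a \<in> carrier B" "b \<in> carrier B" "c \<in> carrier B"
  shows "brace_lambda B (a \<otimes> b) c = brace_lambda B a (brace_lambda B b c)"
proof -
  have "a \<oplus> brace_lambda B a (b \<oplus> brace_lambda B b c) = a \<otimes> b \<oplus> brace_lambda B (a \<otimes> b) c"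
    using assms by (simp add: mult_eq[symmetric] lambda_closed M.m_assoc)
  also have "a \<oplus> brace_lambda B a (b \<oplus> brace_lambda B b c)
      = a \<otimes> b \<oplus> brace_lambda B a (brace_lambda B b c)"
    using assms by (simp add: lambda_add lambda_closed mult_eq A.m_assoc)
  finally show ?thesis
    using assms by (simp add: lambda_closed)
qed

lemma lambda_one: "b \<in> carrier B \<Longrightarrow> brace_lambda B \<one> b = b"
  using zero_eq_one by (metis A.inv_one A.l_one M.l_one brace_lambda_def restrict_apply' )

lemma lambda_auto:
  assumes a: "a \<in> carrier B"
  shows "brace_lambda B a \<in> auto (add_monoid B)"
proof -
  have "bij_betw (brace_lambda B a) (carrier B) (carrier B)"
    by (rule bij_betw_byWitness[where f' = "brace_lambda B (inv a)"])
      (use a in \<open>auto simp: lambda_closed lambda_mult[symmetric] lambda_one\<close>)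
  then show ?thesis
    using a by (auto simp: auto_def Bij_def hom_def lambda_add lambda_closed)
      (simp add: brace_lambda_def)
qed

lemma lambda_hom: "brace_lambda B \<in> hom B (AutoGroup (add_monoid B))"
proof (rule homI)
  show "brace_lambda B a \<in> carrier (AutoGroup (add_monoid B))" if "a \<in> carrier B" for a
    using lambda_auto[OF that] by (simp add: AutoGroup_def)
next
  fix a b assume ab: "a \<in> carrier B" "b \<in> carrier B"
  have "brace_lambda B a \<in> Bij (carrier B)" "brace_lambda B b \<in> Bij (carrier B)"
    using ab lambda_auto by (auto simp: auto_def)
  moreover have "brace_lambda B (a \<otimes> b) = compose (carrier B) (brace_lambda B a) (brace_lambda B b)"
  proof
    fix x
    show "brace_lambda B (a \<otimes> b) x = compose (carrier B) (brace_lambda B a) (brace_lambda B b) x"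
      using ab lambda_mult[of a b x]
      by (cases "x \<in> carrier B") (auto simp: compose_def brace_lambda_def)
  qed
  ultimately show "brace_lambda B (a \<otimes> b)
      = brace_lambda B a \<otimes>\<^bsub>AutoGroup (add_monoid B)\<^esub> brace_lambda B b"
    by (simp add: AutoGroup_def BijGroup_def)
qed

end

context brace_with_epi
begin

lemma eta_hom: "\<eta> \<in> hom B E" and eta_surj: "\<eta> ` carrier B = carrier E"
  using eta_epi by (auto simp: epi_def)

lemma lambda_bar_eta:
  assumes c: "c \<in> carrier B"
  shows "lambda_bar B \<eta> (\<eta> c) = brace_lambda B c"
  unfolding lambda_bar_def
proof (rule the_equality)
  show "\<exists>c'\<in>carrier B. \<eta> c' = \<eta> c \<and> brace_lambda B c = brace_lambda B c'"
    using c by blast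
next
  interpret M: group B by (rule mult_group)
  interpret h: group_hom B E \<eta>
    by unfold_locales (rule eta_hom)
  fix \<phi> assume "\<exists>c'\<in>carrier B. \<eta> c' = \<eta> c \<and> \<phi> = brace_lambda B c'"
  then obtain c' where c': "c' \<in> carrier B" "\<eta> c' = \<eta> c" "\<phi> = brace_lambda B c'"
    by blast
  have "c' \<otimes> inv c \<in> kernel B E \<eta>"
    using c c' by (simp add: kernel_def)
  then have "brace_lambda B (c' \<otimes> inv c) = (\<lambda>x\<in>carrier B. x)"
    using ker_eta by (auto simp: kernel_def AutoGroup_def BijGroup_def)
  then have "brace_lambda B c' x = brace_lambda B c x" if "x \<in> carrier B" for x
    using lambda_mult[of "c' \<otimes> inv c" c x] c c' that by (simp add: M.m_assoc lambda_closed)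
  then show "\<phi> = brace_lambda B c"
    unfolding c'(3) by (auto simp: fun_eq_iff brace_lambda_def)
qed

interpretation A: group "add_monoid B"
  rewrites "carrier (add_monoid B) = carrier B"
    and "mult (add_monoid B) = add B"
    and "one (add_monoid B) = \<zero>"
    and "m_inv (add_monoid B) = a_inv B"
  using add_group by (auto simp: a_inv_def)

interpretation M: group B by (rule mult_group)

interpretation h: group_hom B E \<eta>
  by unfold_locales (rule eta_hom)

abbreviation "act \<equiv> lambda_bar B \<eta>"

lemma assoc_group_simps:
  "carrier (assoc_group B E \<eta>) = carrier B \<times> carrier E"
  "(k, e) \<otimes>\<^bsub>assoc_group B E \<eta>\<^esub> (k', e') = (k \<oplus> act e k', e \<otimes>\<^bsub>E\<^esub> e')"
  "\<one>\<^bsub>assoc_group B E \<eta>\<^esub> = (\<zero>, \<one>\<^bsub>E\<^esub>)"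
  by (simp_all add: assoc_group_def semidirect_def)

lemma carrier_E_cases: "e \<in> carrier E \<Longrightarrow> \<exists>c\<in>carrier B. e = \<eta> c"
  using eta_surj by blast

lemma act_closed: "\<lbrakk>e \<in> carrier E; b \<in> carrier B\<rbrakk> \<Longrightarrow> act e b \<in> carrier B"
  using carrier_E_cases[of e] by (auto simp: lambda_bar_eta lambda_closed)

lemma act_add: "\<lbrakk>e \<in> carrier E; b \<in> carrier B; c \<in> carrier B\<rbrakk> \<Longrightarrow> act e (b \<oplus> c) = act e b \<oplus> act e c"
  using carrier_E_cases[of e] by (auto simp: lambda_bar_eta lambda_add)

lemma act_mult:
  assumes "e \<in> carrier E" "e' \<in> carrier E" "b \<in> carrier B"
  shows "act (e \<otimes>\<^bsub>E\<^esub> e') b = act e (act e' b)"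
proof -
  obtain c c' where "c \<in> carrier B" "e = \<eta> c" "c' \<in> carrier B" "e' = \<eta> c'"
    using assms carrier_E_cases by metis
  then show ?thesis
    using assms lambda_bar_eta[of "c \<otimes> c'"] by (simp add: lambda_bar_eta lambda_mult)
qed

lemma act_one: "b \<in> carrier B \<Longrightarrow> act \<one>\<^bsub>E\<^esub> b = b"
  using lambda_bar_eta[of \<one>] by (simp add: lambda_one)

lemma act_zero: "e \<in> carrier E \<Longrightarrow> act e \<zero> = \<zero>"
  using act_add[of e \<zero> \<zero>] act_closed[of e \<zero>] by simp

lemma assoc_group_group: "group (assoc_group B E \<eta>)"
proof (rule groupI, unfold assoc_group_simps)
  show "\<exists>y\<in>carrier B \<times> carrier E. y \<otimes>\<^bsub>assoc_group B E \<eta>\<^esub> x = (\<zero>, \<one>\<^bsub>E\<^esub>)"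
    if xc: "x \<in> carrier B \<times> carrier E" for x
  proof -
    from xc obtain k e where x: "x = (k, e)" "k \<in> carrier B" "e \<in> carrier E"
      by auto
    have "(\<ominus> (act (inv\<^bsub>E\<^esub> e) k), inv\<^bsub>E\<^esub> e) \<otimes>\<^bsub>assoc_group B E \<eta>\<^esub> x = (\<zero>, \<one>\<^bsub>E\<^esub>)"
      using x by (simp add: assoc_group_simps act_closed)
    then show ?thesis
      using x by (intro bexI) (auto simp: act_closed)
  qed
qed (auto simp: assoc_group_simps act_closed act_add act_mult act_one A.m_assoc E.m_assoc)

lemma incl_mult:
  "\<lbrakk>k \<in> carrier B; e \<in> carrier E\<rbrakk> \<Longrightarrow> inclK E k \<otimes>\<^bsub>assoc_group B E \<eta>\<^esub> inclE B e = (k, e)"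
  by (simp add: inclK_def inclE_def assoc_group_simps act_one)

lemma assoc_trifact_eq:
  "assoc_trifact B E \<eta> = (assoc_group B E \<eta>, carrier B \<times> {\<one>\<^bsub>E\<^esub>},
    (\<lambda>c. (c, \<eta> c)) ` carrier B, {\<zero>} \<times> carrier E)"
proof -
  have "{inclK E c \<otimes>\<^bsub>assoc_group B E \<eta>\<^esub> inclE B (\<eta> c) |c. c \<in> carrier B} = (\<lambda>c. (c, \<eta> c)) ` carrier B"
    by (force simp: incl_mult)
  then show ?thesis
    by (auto simp: assoc_trifact_def inclK_def inclE_def)
qed

lemma lambda_eta_add: "\<lbrakk>a \<in> carrier B; b \<in> carrier B\<rbrakk> \<Longrightarrow> a \<oplus> act (\<eta> a) b = a \<otimes> b"
  by (simp add: lambda_bar_eta mult_eq)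

lemma trifactorised_assoc_trifact: "trifactorised_group (assoc_trifact B E \<eta>)"
proof -
  let ?G = "assoc_group B E \<eta>"
  let ?K = "carrier B \<times> {\<one>\<^bsub>E\<^esub>}" and ?H = "(\<lambda>c. (c, \<eta> c)) ` carrier B" and ?E = "{\<zero>} \<times> carrier E"
  interpret G: group ?G by (rule assoc_group_group)
  have homsnd: "snd \<in> hom ?G E"
    by (rule homI) (auto simp: assoc_group_simps)
  interpret s: group_hom ?G E snd
    by unfold_locales (rule homsnd)
  have "kernel ?G E snd = ?K"
    by (auto simp: kernel_def assoc_group_simps)
  then have K: "?K \<lhd> ?G"
    using s.normal_kernel by simp
  have homE: "(\<lambda>e. (\<zero>, e)) \<in> hom E ?G"
    by (rule homI) (auto simp: assoc_group_simps act_zero)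
  interpret e: group_hom E ?G "\<lambda>e. (\<zero>, e)"
    by unfold_locales (rule homE)
  have E: "subgroup ?E ?G"
  proof -
    have "?E = (\<lambda>e. (\<zero>, e)) ` carrier E" by auto
    then show ?thesis using e.img_is_subgroup by simp
  qed
  have homH: "(\<lambda>c. (c, \<eta> c)) \<in> hom B ?G"
    by (rule homI) (auto simp: assoc_group_simps lambda_eta_add)
  interpret H: group_hom B ?G "\<lambda>c. (c, \<eta> c)"
    by unfold_locales (rule homH)
  have H: "subgroup ?H ?G"
    using H.img_is_subgroup .
  have sub: "X <#>\<^bsub>?G\<^esub> Y \<subseteq> carrier ?G" if "X \<subseteq> carrier ?G" "Y \<subseteq> carrier ?G" for X Y
    using that by (rule G.set_mult_closed)
  have mem: "z \<in> X <#>\<^bsub>?G\<^esub> Y" if "x \<in> X" "y \<in> Y" "z = x \<otimes>\<^bsub>?G\<^esub> y" for x y z X Y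
    using that by (auto simp: set_mult_def)
  have KE: "carrier ?G = ?K <#>\<^bsub>?G\<^esub> ?E"
  proof
    show "carrier ?G \<subseteq> ?K <#>\<^bsub>?G\<^esub> ?E"
    proof
      fix z assume "z \<in> carrier ?G"
      then obtain k e where z: "z = (k, e)" "k \<in> carrier B" "e \<in> carrier E"
        by (auto simp: assoc_group_simps)
      show "z \<in> ?K <#>\<^bsub>?G\<^esub> ?E"
        by (rule mem[of "(k, \<one>\<^bsub>E\<^esub>)" _ "(\<zero>, e)"]) (use z in \<open>auto simp: assoc_group_simps act_one\<close>)
    qed
  qed (rule sub, auto simp: assoc_group_simps)
  have KH: "carrier ?G = ?K <#>\<^bsub>?G\<^esub> ?H"
  proof
    show "carrier ?G \<subseteq> ?K <#>\<^bsub>?G\<^esub> ?H"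
    proof
      fix z assume "z \<in> carrier ?G"
      then obtain k c where z: "z = (k, \<eta> c)" "k \<in> carrier B" "c \<in> carrier B"
        by (auto simp: assoc_group_simps dest!: carrier_E_cases)
      show "z \<in> ?K <#>\<^bsub>?G\<^esub> ?H"
        by (rule mem[of "(k \<oplus> \<ominus> c, \<one>\<^bsub>E\<^esub>)" _ "(c, \<eta> c)"])
          (use z in \<open>auto simp: assoc_group_simps act_one A.m_assoc\<close>)
    qed
  qed (rule sub, auto simp: assoc_group_simps)
  have HE: "carrier ?G = ?H <#>\<^bsub>?G\<^esub> ?E"
  proof
    show "carrier ?G \<subseteq> ?H <#>\<^bsub>?G\<^esub> ?E"
    proof
      fix z assume "z \<in> carrier ?G"
      then obtain k e where z: "z = (k, e)" "k \<in> carrier B" "e \<in> carrier E"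
        by (auto simp: assoc_group_simps)
      obtain d where d: "d \<in> carrier E" "\<eta> k \<otimes>\<^bsub>E\<^esub> d = e"
      proof
        show "inv\<^bsub>E\<^esub> (\<eta> k) \<otimes>\<^bsub>E\<^esub> e \<in> carrier E" "\<eta> k \<otimes>\<^bsub>E\<^esub> (inv\<^bsub>E\<^esub> (\<eta> k) \<otimes>\<^bsub>E\<^esub> e) = e"
          using z by (simp_all add: E.m_assoc[symmetric])
      qed
      show "z \<in> ?H <#>\<^bsub>?G\<^esub> ?E"
        by (rule mem[of "(k, \<eta> k)" _ "(\<zero>, d)"])
          (use z d in \<open>auto simp: assoc_group_simps act_zero\<close>)
    qed
  qed (rule sub, auto simp: assoc_group_simps)
  have "?K \<inter> ?E = {\<one>\<^bsub>?G\<^esub>}" "?H \<inter> ?E = {\<one>\<^bsub>?G\<^esub>}"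
    using zero_eq_one by (auto simp: assoc_group_simps intro!: image_eqI[of _ _ \<zero>])
  then show ?thesis
    using KE KH HE K H E G.is_group unfolding assoc_trifact_eq trifactorised_group_def by blast
qed

end

section \<open>The kernel condition for monomorphisms\<close>

text \<open>If the induced map \<open>g\<close> is injective, then \<open>f ` kernel B1 E1 \<eta>1\<close> is the part of
  \<open>kernel B2 E2 \<eta>2\<close> that lies in the image of \<open>f\<close>, but it need not be all of \<open>kernel B2 E2 \<eta>2\<close>. In the
  following example \<open>B1\<close> is the zero brace, \<open>B2\<close> the integers with both operations equal to addition,
  \<open>f\<close> the inclusion, and \<open>E1\<close>, \<open>E2\<close> are trivial.\<close>

definition Z_brace :: "int set \<Rightarrow> int ring"
  where "Z_brace S = \<lparr>carrier = S, mult = (+), one = 0, zero = 0, add = (+)\<rparr>"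

definition triv_group :: "unit monoid"
  where "triv_group = \<lparr>carrier = {()}, mult = (\<lambda>_ _. ()), one = ()\<rparr>"

lemma mon_kernel_counterexample:
  fixes B1 B2 :: "int ring" and E :: "unit monoid" and \<eta> :: "int \<Rightarrow> unit"
    and f :: "int \<Rightarrow> int" and g :: "int \<times> unit \<Rightarrow> int \<times> unit"
  defines "B1 \<equiv> Z_brace {0}" and "B2 \<equiv> Z_brace UNIV" and "E \<equiv> triv_group"
    and "\<eta> \<equiv> \<lambda>_. ()" and "f \<equiv> \<lambda>x. x" and "g \<equiv> \<lambda>x. x"
  shows "brace_with_epi B1 E \<eta>" "brace_with_epi B2 E \<eta>"
    "f \<in> brace_mon B1 B2" "f ` kernel B1 E \<eta> \<subseteq> kernel B2 E \<eta>"
    "is_induced_map B1 E \<eta> B2 E \<eta> f g"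
    "g \<in> trifact_mon (assoc_trifact B1 E \<eta>) (assoc_trifact B2 E \<eta>)"
    "f ` kernel B1 E \<eta> \<noteq> kernel B2 E \<eta>"
proof -
  have neg: "\<exists>y. y + x = 0" for x :: int
    by (rule exI[of _ "- x"]) simp
  have Zgrp: "group \<lparr>carrier = S, mult = (+), one = 0::int\<rparr>" "group (Z_brace S)"
    if "S = {0} \<or> S = UNIV" for S
    using that by (auto intro!: groupI simp: Z_brace_def neg)
  have E: "group triv_group"
    by (rule groupI) (auto simp: triv_group_def)
  have minus: "a_inv (Z_brace S) a = - a" if "S = {0} \<or> S = UNIV" "a \<in> S" for S a
    unfolding a_inv_def using that Zgrp(1)[OF that(1)]
    by (intro group.inv_equality) (auto simp: Z_brace_def)
  have brace: "skew_left_brace (Z_brace S)" if "S = {0} \<or> S = UNIV" for S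
  proof (rule skew_left_brace.intro)
    show "group (add_monoid (Z_brace S))"
      using Zgrp(1)[OF that] by (simp add: Z_brace_def)
    fix a b c assume "a \<in> carrier (Z_brace S)"
    then show "a \<otimes>\<^bsub>Z_brace S\<^esub> (b \<oplus>\<^bsub>Z_brace S\<^esub> c) = a \<otimes>\<^bsub>Z_brace S\<^esub> b \<oplus>\<^bsub>Z_brace S\<^esub> \<ominus>\<^bsub>Z_brace S\<^esub> a \<oplus>\<^bsub>Z_brace S\<^esub> a \<otimes>\<^bsub>Z_brace S\<^esub> c"
      using minus[OF that, of a] by (simp add: Z_brace_def)
  qed (rule Zgrp(2)[OF that])
  have lam: "brace_lambda (Z_brace S) a = (\<lambda>x\<in>S. x)" if "S = {0} \<or> S = UNIV" "a \<in> S" for S a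
    using minus[OF that] by (auto simp: brace_lambda_def Z_brace_def fun_eq_iff)
  have epi: "brace_with_epi (Z_brace S) triv_group \<eta>" if S: "S = {0} \<or> S = UNIV" for S
  proof (intro brace_with_epi.intro brace_with_epi_axioms.intro brace[OF S] E)
    show "\<eta> \<in> epi (Z_brace S) triv_group"
      using S by (auto simp: epi_def hom_def triv_group_def Z_brace_def \<eta>_def)
    show "kernel (Z_brace S) triv_group \<eta> \<subseteq>
        kernel (Z_brace S) (AutoGroup (add_monoid (Z_brace S))) (brace_lambda (Z_brace S))"
      using lam[OF S] by (auto simp: kernel_def Z_brace_def AutoGroup_def BijGroup_def)
  qed
  show e1: "brace_with_epi B1 E \<eta>" and e2: "brace_with_epi B2 E \<eta>"
    using epi by (auto simp: B1_def B2_def E_def)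
  have ne: "{0::int} \<noteq> UNIV"
    by (metis UNIV_I singletonD zero_neq_one)
  show "f \<in> brace_mon B1 B2" "f ` kernel B1 E \<eta> \<subseteq> kernel B2 E \<eta>"
    "f ` kernel B1 E \<eta> \<noteq> kernel B2 E \<eta>"
    using ne by (auto simp: brace_mon_def brace_hom_def hom_def B1_def B2_def E_def f_def \<eta>_def kernel_def
        Z_brace_def triv_group_def)
  have c: "carrier B1 = {0}" "carrier B2 = UNIV" "carrier E = {()}"
    by (auto simp: B1_def B2_def E_def Z_brace_def triv_group_def)
  show "is_induced_map B1 E \<eta> B2 E \<eta> f g"
    by (simp add: is_induced_map_def brace_with_epi.incl_mult[OF e1, unfolded \<eta>_def]
        brace_with_epi.incl_mult[OF e2, unfolded \<eta>_def] c f_def g_def \<eta>_def)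
  have a: "lambda_bar B1 \<eta> () 0 = 0" "lambda_bar B2 \<eta> () 0 = 0"
  proof -
    have "carrier (Z_brace S) = S" for S
      by (simp add: Z_brace_def)
    then show "lambda_bar B1 \<eta> () 0 = 0" "lambda_bar B2 \<eta> () 0 = 0"
    using brace_with_epi.lambda_bar_eta[OF e1, of 0] brace_with_epi.lambda_bar_eta[OF e2, of 0]
      lam[of "{0}" 0] lam[of UNIV 0] by (auto simp: \<eta>_def B1_def B2_def)
  qed
  have z: "\<zero>\<^bsub>B1\<^esub> = 0" "\<zero>\<^bsub>B2\<^esub> = 0" "add B1 = (+)" "add B2 = (+)"
    by (auto simp: B1_def B2_def Z_brace_def)
  show "g \<in> trifact_mon (assoc_trifact B1 E \<eta>) (assoc_trifact B2 E \<eta>)"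
    by (auto simp: trifact_mon_def trifact_hom_def brace_with_epi.assoc_trifact_eq[OF e1]
        brace_with_epi.assoc_trifact_eq[OF e2] hom_def brace_with_epi.assoc_group_simps[OF e1]
        brace_with_epi.assoc_group_simps[OF e2] c a z g_def)
qed

end

theory Submission
  imports Defs
begin

text \<open>The brace homomorphism \<open>f\<close> sends the kernel of \<open>\<eta>1\<close> into that of \<open>\<eta>2\<close>, so \<open>\<eta>2 \<circ> f\<close> factors through
  the epimorphism \<open>\<eta>1\<close> as \<open>\<phi> \<circ> \<eta>1\<close> for a unique homomorphism \<open>\<phi>\<close> from \<open>E1\<close> to \<open>E2\<close>. Since the lambda
  map is an expression in the two brace operations, \<open>f\<close> is equivariant along \<open>\<phi>\<close> for the actions that
  define the two semidirect products. Hence \<open>map_prod f \<phi>\<close> is a homomorphism between them, and it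
  respects the three distinguished subgroups, the graph of \<open>\<eta>1\<close> going into that of \<open>\<eta>2\<close> by the very
  equation \<open>\<phi> \<circ> \<eta>1 = \<eta>2 \<circ> f\<close> on \<open>B1\<close>. It is the induced map, because an element
  \<open>k \<eta>1(c)\<close> of the first semidirect product is the pair \<open>(k, \<eta>1 c)\<close>, and its restriction to the
  copy of the additive group is \<open>f\<close>.

  Injectivity and surjectivity can now be read off componentwise. The map \<open>\<phi>\<close> is onto as soon as
  \<open>f\<close> is, because \<open>\<eta>2\<close> is onto; and \<open>\<phi>\<close> is injective exactly when an element of \<open>B1\<close> that \<open>f\<close> sends
  into the kernel of \<open>\<eta>2\<close> already lies in the kernel of \<open>\<eta>1\<close>. For injective \<open>f\<close> the latter says that the
  image of the first kernel is the part of the second kernel inside the image of \<open>f\<close>.\<close>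

locale brace_with_epi_hom =
  S: brace_with_epi B1 E1 \<eta>1 + T: brace_with_epi B2 E2 \<eta>2
  for B1 :: "('b, 'm) ring_scheme" and E1 :: "('e, 'n) monoid_scheme" and \<eta>1 :: "'b \<Rightarrow> 'e"
    and B2 :: "('c, 'p) ring_scheme" and E2 :: "('d, 'q) monoid_scheme" and \<eta>2 :: "'c \<Rightarrow> 'd" +
  fixes f :: "'b \<Rightarrow> 'c"
  assumes brace_hom: "f \<in> brace_hom B1 B2"
    and kernel_subset: "f ` kernel B1 E1 \<eta>1 \<subseteq> kernel B2 E2 \<eta>2"
begin

sublocale add_hom: group_hom "add_monoid B1" "add_monoid B2" f
  rewrites "carrier (add_monoid B1) = carrier B1" and "carrier (add_monoid B2) = carrier B2"
    and "mult (add_monoid B1) = add B1" and "mult (add_monoid B2) = add B2"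
    and "one (add_monoid B1) = \<zero>\<^bsub>B1\<^esub>" and "one (add_monoid B2) = \<zero>\<^bsub>B2\<^esub>"
    and "m_inv (add_monoid B1) = a_inv B1" and "m_inv (add_monoid B2) = a_inv B2"
  using S.add_group T.add_group brace_hom
  by (auto simp: brace_hom_def group_hom_def group_hom_axioms_def a_inv_def)

sublocale mult_hom: group_hom B1 B2 f
  using S.mult_group T.mult_group brace_hom
  by (auto simp: brace_hom_def group_hom_def group_hom_axioms_def)

sublocale eta1: group_hom B1 E1 \<eta>1
  by unfold_locales (rule S.eta_hom)

sublocale eta2: group_hom B2 E2 \<eta>2
  by unfold_locales (rule T.eta_hom)

lemma hom_lambda:
  "\<lbrakk>c \<in> carrier B1; k \<in> carrier B1\<rbrakk> \<Longrightarrow> f (brace_lambda B1 c k) = brace_lambda B2 (f c) (f k)"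
  by (simp add: brace_lambda_def)

text \<open>The chosen preimage under \<open>\<eta>1\<close> is immaterial by \<open>phi_eta\<close> below.\<close>

definition phi :: "'e \<Rightarrow> 'd"
  where "phi e = \<eta>2 (f (inv_into (carrier B1) \<eta>1 e))"

text \<open>Two preimages under \<open>\<eta>1\<close> differ by an element of the kernel, which \<open>\<eta>2 \<circ> f\<close> sends to the
  identity.\<close>

lemma phi_eta:
  assumes c: "c \<in> carrier B1"
  shows "phi (\<eta>1 c) = \<eta>2 (f c)"
proof -
  define d where "d = inv_into (carrier B1) \<eta>1 (\<eta>1 c)"
  have d: "d \<in> carrier B1" "\<eta>1 d = \<eta>1 c"
    unfolding d_def using c by (auto intro: inv_into_into f_inv_into_f)
  then have "d \<otimes>\<^bsub>B1\<^esub> inv\<^bsub>B1\<^esub> c \<in> kernel B1 E1 \<eta>1"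
    using c by (simp add: kernel_def)
  then have "f (d \<otimes>\<^bsub>B1\<^esub> inv\<^bsub>B1\<^esub> c) \<in> kernel B2 E2 \<eta>2"
    using kernel_subset by blast
  then have "\<eta>2 (f d) \<otimes>\<^bsub>E2\<^esub> inv\<^bsub>E2\<^esub> \<eta>2 (f c) = \<one>\<^bsub>E2\<^esub>"
    using c d by (simp add: kernel_def)
  then have "\<eta>2 (f d) = \<eta>2 (f c)"
    using c d T.E.inv_equality[of "\<eta>2 (f d)" "inv\<^bsub>E2\<^esub> \<eta>2 (f c)"] by simp
  then show ?thesis
    by (simp add: phi_def d_def)
qed

lemma phi_hom: "phi \<in> hom E1 E2"
proof (rule homI)
  fix x y assume "x \<in> carrier E1" "y \<in> carrier E1"
  then obtain c d where cd: "c \<in> carrier B1" "x = \<eta>1 c" "d \<in> carrier B1" "y = \<eta>1 d"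
    using S.carrier_E_cases by metis
  then show "phi (x \<otimes>\<^bsub>E1\<^esub> y) = phi x \<otimes>\<^bsub>E2\<^esub> phi y"
    using phi_eta[of "c \<otimes>\<^bsub>B1\<^esub> d"] by (simp add: phi_eta)
qed (auto simp: phi_eta dest!: S.carrier_E_cases)

sublocale phi: group_hom E1 E2 phi
  by unfold_locales (rule phi_hom)

lemma hom_act:
  "\<lbrakk>e \<in> carrier E1; k \<in> carrier B1\<rbrakk> \<Longrightarrow> f (S.act e k) = T.act (phi e) (f k)"
  by (auto simp: phi_eta S.lambda_bar_eta T.lambda_bar_eta hom_lambda dest!: S.carrier_E_cases)

lemma phi_inj_iff:
  "inj_on phi (carrier E1) \<longleftrightarrow> (\<forall>c\<in>carrier B1. f c \<in> kernel B2 E2 \<eta>2 \<longrightarrow> c \<in> kernel B1 E1 \<eta>1)"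
proof -
  have "inj_on phi (carrier E1) \<longleftrightarrow> (\<forall>e\<in>carrier E1. phi e = \<one>\<^bsub>E2\<^esub> \<longrightarrow> e = \<one>\<^bsub>E1\<^esub>)"
    using phi.inj_on_one_iff by auto
  also have "\<dots> \<longleftrightarrow> (\<forall>c\<in>carrier B1. phi (\<eta>1 c) = \<one>\<^bsub>E2\<^esub> \<longrightarrow> \<eta>1 c = \<one>\<^bsub>E1\<^esub>)"
    unfolding S.eta_surj[symmetric] by blast
  finally show ?thesis
    by (auto simp: kernel_def phi_eta)
qed

text \<open>The inclusion of the left-hand side of the kernel equation in its right-hand side always holds;
  injectivity of \<open>f\<close> is what lets membership of \<open>f c\<close> in the image of the first kernel be pulled back
  to \<open>c\<close> itself.\<close>

lemma phi_inj_iff_kernel: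
  assumes "inj_on f (carrier B1)"
  shows "inj_on phi (carrier E1) \<longleftrightarrow>
    f ` kernel B1 E1 \<eta>1 = kernel B2 E2 \<eta>2 \<inter> f ` carrier B1" (is "_ \<longleftrightarrow> ?R")
proof -
  have K: "kernel B1 E1 \<eta>1 \<subseteq> carrier B1"
    by (auto simp: kernel_def)
  have "f c \<in> f ` kernel B1 E1 \<eta>1 \<longleftrightarrow> c \<in> kernel B1 E1 \<eta>1" if "c \<in> carrier B1" for c
    using inj_on_image_mem_iff[OF assms that K] .
  then have "?R \<longleftrightarrow> (\<forall>c\<in>carrier B1. f c \<in> kernel B2 E2 \<eta>2 \<longrightarrow> c \<in> kernel B1 E1 \<eta>1)"
    using K kernel_subset by blast
  then show ?thesis
    by (simp add: phi_inj_iff)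
qed

lemma phi_surj:
  assumes "f ` carrier B1 = carrier B2"
  shows "phi ` carrier E1 = carrier E2"
proof -
  have "phi ` \<eta>1 ` carrier B1 = \<eta>2 ` f ` carrier B1"
    by (auto simp: image_image phi_eta)
  then show ?thesis
    by (simp add: assms S.eta_surj T.eta_surj)
qed

lemma is_induced_map_iff:
  "is_induced_map B1 E1 \<eta>1 B2 E2 \<eta>2 f g \<longleftrightarrow>
    (\<forall>x\<in>carrier (assoc_group B1 E1 \<eta>1). g x = map_prod f phi x)"
  unfolding is_induced_map_def S.assoc_group_simps S.eta_surj[symmetric]
  by (auto simp: S.incl_mult T.incl_mult phi_eta)

lemma ex1_induced_map:
  "\<exists>!g. g \<in> extensional (carrier (assoc_group B1 E1 \<eta>1)) \<and>
    is_induced_map B1 E1 \<eta>1 B2 E2 \<eta>2 f g"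
  unfolding is_induced_map_iff
  by (rule ex1I[of _ "restrict (map_prod f phi) (carrier (assoc_group B1 E1 \<eta>1))"])
    (auto intro: extensionalityI)

context
  fixes g
  assumes induced: "is_induced_map B1 E1 \<eta>1 B2 E2 \<eta>2 f g"
begin

lemma induced_map_eq:
  "\<lbrakk>k \<in> carrier B1; e \<in> carrier E1\<rbrakk> \<Longrightarrow> g (k, e) = (f k, phi e)"
  using induced by (simp add: is_induced_map_iff S.assoc_group_simps)

lemma induced_map_trifact_hom:
  "g \<in> trifact_hom (assoc_trifact B1 E1 \<eta>1) (assoc_trifact B2 E2 \<eta>2)"
proof -
  have "g \<in> hom (assoc_group B1 E1 \<eta>1) (assoc_group B2 E2 \<eta>2)"
    by (rule homI)
      (auto simp: S.assoc_group_simps T.assoc_group_simps induced_map_eq S.act_closed hom_act)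
  then show ?thesis
    by (auto simp: trifact_hom_def S.assoc_trifact_eq T.assoc_trifact_eq induced_map_eq phi_eta)
qed

lemma brace_restriction_induced_map:
  "brace_restriction B1 E1 B2 E2 g = restrict f (carrier B1)"
proof -
  have "inj_on (inclK E2) (carrier B2)"
    by (simp add: inj_on_def inclK_def)
  moreover have "g (inclK E1 b) = inclK E2 (f b)" if "b \<in> carrier B1" for b
    using that by (simp add: inclK_def induced_map_eq)
  ultimately show ?thesis
    unfolding brace_restriction_def by (intro restrict_ext) simp
qed

lemma induced_map_image:
  "g ` carrier (assoc_group B1 E1 \<eta>1) = f ` carrier B1 \<times> phi ` carrier E1"
  by (force simp: S.assoc_group_simps induced_map_eq)

lemma induced_map_inj_iff:
  "inj_on g (carrier (assoc_group B1 E1 \<eta>1)) \<longleftrightarrow>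
    inj_on f (carrier B1) \<and> inj_on phi (carrier E1)"
  using add_hom.G.one_closed S.E.one_closed
  by (fastforce simp: inj_on_def S.assoc_group_simps induced_map_eq)

lemma induced_map_surj_iff:
  "g ` carrier (assoc_group B1 E1 \<eta>1) = carrier (assoc_group B2 E2 \<eta>2) \<longleftrightarrow>
    f ` carrier B1 = carrier B2"
  using phi_surj add_hom.H.one_closed T.E.one_closed
  unfolding induced_map_image T.assoc_group_simps by (auto simp: times_eq_iff)

lemma induced_map_epi_iff:
  "g \<in> trifact_epi (assoc_trifact B1 E1 \<eta>1) (assoc_trifact B2 E2 \<eta>2) \<longleftrightarrow> f \<in> brace_epi B1 B2"
  using induced_map_trifact_hom brace_hom induced_map_surj_iff
  by (simp add: trifact_epi_def brace_epi_def assoc_trifact_def)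

lemma induced_map_mon_iff:
  "g \<in> trifact_mon (assoc_trifact B1 E1 \<eta>1) (assoc_trifact B2 E2 \<eta>2) \<longleftrightarrow>
    f \<in> brace_mon B1 B2 \<and> f ` kernel B1 E1 \<eta>1 = kernel B2 E2 \<eta>2 \<inter> f ` carrier B1"
  using induced_map_trifact_hom brace_hom induced_map_inj_iff phi_inj_iff_kernel
  by (auto simp: trifact_mon_def brace_mon_def assoc_trifact_def)

text \<open>Once \<open>f\<close> is onto, the whole second kernel lies in its image.\<close>

lemma induced_map_iso_iff:
  "g \<in> trifact_iso (assoc_trifact B1 E1 \<eta>1) (assoc_trifact B2 E2 \<eta>2) \<longleftrightarrow>
    f \<in> brace_iso B1 B2 \<and> f ` kernel B1 E1 \<eta>1 = kernel B2 E2 \<eta>2"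
proof -
  have "g \<in> trifact_iso (assoc_trifact B1 E1 \<eta>1) (assoc_trifact B2 E2 \<eta>2) \<longleftrightarrow>
      g \<in> trifact_mon (assoc_trifact B1 E1 \<eta>1) (assoc_trifact B2 E2 \<eta>2) \<and>
      g \<in> trifact_epi (assoc_trifact B1 E1 \<eta>1) (assoc_trifact B2 E2 \<eta>2)"
    by (auto simp: trifact_iso_def trifact_mon_def trifact_epi_def bij_betw_def)
  moreover have "f \<in> brace_iso B1 B2 \<longleftrightarrow> f \<in> brace_mon B1 B2 \<and> f \<in> brace_epi B1 B2"
    by (auto simp: brace_iso_def brace_mon_def brace_epi_def bij_betw_def)
  moreover have "kernel B2 E2 \<eta>2 \<inter> f ` carrier B1 = kernel B2 E2 \<eta>2" if "f \<in> brace_epi B1 B2"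
    using that by (auto simp: brace_epi_def kernel_def)
  ultimately show ?thesis
    unfolding induced_map_mon_iff induced_map_epi_iff by metis
qed

end

end

theorem proposition3p12:
  fixes B1 :: "('b, 'm) ring_scheme" and E1 :: "('e, 'n) monoid_scheme" and \<eta>1 :: "'b \<Rightarrow> 'e"
    and B2 :: "('c, 'p) ring_scheme" and E2 :: "('d, 'q) monoid_scheme" and \<eta>2 :: "'c \<Rightarrow> 'd"
    and f :: "'b \<Rightarrow> 'c"
  assumes "brace_with_epi B1 E1 \<eta>1" and "brace_with_epi B2 E2 \<eta>2"
    and "f \<in> brace_hom B1 B2"
    and "f ` kernel B1 E1 \<eta>1 \<subseteq> kernel B2 E2 \<eta>2"
  shows "(\<exists>!g. g \<in> extensional (carrier (assoc_group B1 E1 \<eta>1)) \<and>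
      is_induced_map B1 E1 \<eta>1 B2 E2 \<eta>2 f g) \<and>
    (\<forall>fbar. is_induced_map B1 E1 \<eta>1 B2 E2 \<eta>2 f fbar \<longrightarrow>
      fbar \<in> trifact_hom (assoc_trifact B1 E1 \<eta>1) (assoc_trifact B2 E2 \<eta>2) \<and>
      brace_restriction B1 E1 B2 E2 fbar = restrict f (carrier B1) \<and>
      (f \<in> brace_epi B1 B2 \<longrightarrow>
        fbar \<in> trifact_epi (assoc_trifact B1 E1 \<eta>1) (assoc_trifact B2 E2 \<eta>2)) \<and>
      (fbar \<in> trifact_mon (assoc_trifact B1 E1 \<eta>1) (assoc_trifact B2 E2 \<eta>2) \<longleftrightarrow>
        f \<in> brace_mon B1 B2 \<and>
        f ` kernel B1 E1 \<eta>1 = kernel B2 E2 \<eta>2 \<inter> f ` carrier B1) \<and>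
      (f \<in> brace_mon B1 B2 \<and> f ` kernel B1 E1 \<eta>1 = kernel B2 E2 \<eta>2 \<longrightarrow>
        fbar \<in> trifact_mon (assoc_trifact B1 E1 \<eta>1) (assoc_trifact B2 E2 \<eta>2)) \<and>
      (fbar \<in> trifact_iso (assoc_trifact B1 E1 \<eta>1) (assoc_trifact B2 E2 \<eta>2) \<longleftrightarrow>
        f \<in> brace_iso B1 B2 \<and> f ` kernel B1 E1 \<eta>1 = kernel B2 E2 \<eta>2))"
proof -
  interpret brace_with_epi_hom B1 E1 \<eta>1 B2 E2 \<eta>2 f
    using assms by (intro brace_with_epi_hom.intro brace_with_epi_hom_axioms.intro)
  have "f ` kernel B1 E1 \<eta>1 = kernel B2 E2 \<eta>2 \<inter> f ` carrier B1"
    if "f ` kernel B1 E1 \<eta>1 = kernel B2 E2 \<eta>2"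
    using that by (auto simp: kernel_def)
  then show ?thesis
    using ex1_induced_map induced_map_trifact_hom brace_restriction_induced_map
      induced_map_epi_iff induced_map_mon_iff induced_map_iso_iff
    by simp
qed

end
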